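(* For all $n,k\in\mathbb{N}$, the Changhee polynomials of the first kind with order $k$ satisfy $$Ch_n^{(k)}(x)=\sum_{i=0}^n (-1)^i\,\frac{n!}{2^i}\binom{k+i-1}{i}\binom{x}{n-i}.$$
   Context: For $k\in\mathbb{N}$, the Changhee polynomials of the first kind with order $k$, denoted $Ch_n^{(k)}(x)$, $n\ge 0$, are defined by the generating function (an identity of formal power series in $t$, with $x$ an indeterminate) $$\sum_{n=0}^\infty Ch_n^{(k)}(x)\frac{t^n}{n!}=\left(\frac{2}{2+t}\right)^k(1+t)^x .$$ Here $\binom{x}{j}=\frac{x(x-1)\cdots(x-j+1)}{j!}$ is the generalized binomial coefficient (a polynomial in $x$), with $\binom{x}{0}=1$, and $(1+t)^x=\sum_{j\ge 0}\binom{x}{j}t^j$. $\mathbb{N}$ denotes the positive integers. *)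

theory Defs
  imports "HOL-Computational_Algebra.Computational_Algebra"
begin

(* The series live in ('a poly) fps: the coefficient polynomials are in the indeterminate
   x = [:0, 1:] and t = fps_X. The type 'a poly is not a field, so 2 / (2 + t) is formed over
   the field 'a and its coefficients are then embedded as constant polynomials. *)

definition fps_const_poly :: "'a::zero fps \<Rightarrow> 'a poly fps" where
  "fps_const_poly F = Abs_fps (\<lambda>n. [:fps_nth F n:])"

(* x (x - 1) ... (x - j + 1) / j!; gchoose itself is constrained to fields, hence not
   applicable to the indeterminate x, but agrees with this after evaluation. *)
definition binomial_poly :: "nat \<Rightarrow> 'a::field_char_0 poly" where
  "binomial_poly j = smult (1 / fact j) (\<Prod>i<j. [:0, 1:] - of_nat i)"

lemma poly_binomial_poly: "poly (binomial_poly j) a = a gchoose j"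
  by (simp add: binomial_poly_def gbinomial_prod_rev poly_prod atLeast0LessThan)

(* (1 + t)^x *)
definition one_plus_t_power_x :: "'a::field_char_0 poly fps" where
  "one_plus_t_power_x = Abs_fps binomial_poly"

definition changhee_gf :: "nat \<Rightarrow> 'a::field_char_0 poly fps" where
  "changhee_gf k = fps_const_poly ((2 / (2 + fps_X)) ^ k) * one_plus_t_power_x"

definition changhee_poly :: "nat \<Rightarrow> nat \<Rightarrow> 'a::field_char_0 poly" where
  "changhee_poly k n = smult (fact n) (fps_nth (changhee_gf k) n)"

lemma changhee_poly_egf:
  "Abs_fps (\<lambda>n. smult (1 / fact n) (changhee_poly k n)) = changhee_gf k"
  by (rule fps_ext) (simp add: changhee_poly_def)

end

theory Submission
  imports Defs
begin

text \<open>
  Since \<open>2 / (2 + t) = 1 / (1 - (-1/2) t)\<close>, the factor \<open>(2 / (2 + t))^k\<close> is given by the negative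
  binomial series, whose \<open>i\<close>-th coefficient is \<open>binom(k + i - 1, i) (-1/2)^i\<close>. The formula is the
  Cauchy product of this series with \<open>(1 + t)^x\<close>, multiplied by \<open>n!\<close>.
\<close>

lemma two_over_two_plus_fps_X:
  "2 / (2 + fps_X) = inverse (1 - fps_const (-1/2) * fps_X :: 'a::field_char_0 fps)"
proof -
  have const_two: "(2 :: 'a fps) = fps_const 2"
    by (simp add: numeral_fps_const)
  have "fps_const (2 :: 'a) * fps_const (-1/2) = fps_const (-1)"
    by (simp only: fps_const_mult) simp
  then have "(2 :: 'a fps) * (1 - fps_const (-1/2) * fps_X) = 2 + fps_X"
    by (simp add: const_two right_diff_distrib mult.assoc [symmetric] flip: fps_const_neg)
  then have "(2 :: 'a fps) / (2 + fps_X) = (2 * 1) / (2 * (1 - fps_const (-1/2) * fps_X))"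
    by (simp only: mult_1_right)
  also have "\<dots> = 1 / (1 - fps_const (-1/2) * fps_X)"
    by (rule div_mult_mult1) simp
  also have "\<dots> = inverse (1 - fps_const (-1/2) * fps_X)"
    by (simp add: fps_divide_unit)
  finally show ?thesis .
qed

lemma fps_nth_two_over_two_plus_fps_X_power:
  assumes "k > 0"
  shows "fps_nth ((2 / (2 + fps_X)) ^ k :: 'a::field_char_0 fps) i =
    (-1) ^ i / 2 ^ i * of_nat ((k + i - 1) choose i)"
proof -
  have "(2 / (2 + fps_X)) ^ k = inverse ((1 - fps_const (-1/2) * fps_X :: 'a fps) ^ k)"
    by (simp only: two_over_two_plus_fps_X fps_inverse_power)
  also have "\<dots> = Abs_fps (\<lambda>i. of_nat ((k + i - 1) choose i) * (-1/2) ^ i)"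
    using assms by (rule one_minus_const_fps_X_neg_power')
  finally show ?thesis
    by (simp only: fps_nth_Abs_fps power_divide mult.commute)
qed

theorem theorem2p4:
  fixes n k :: nat
  assumes "n \<ge> 1" and "k \<ge> 1"
  shows "(changhee_poly k n :: 'a::field_char_0 poly) =
    (\<Sum>i=0..n. smult ((-1) ^ i * (fact n / 2 ^ i) * of_nat ((k + i - 1) choose i))
                     (binomial_poly (n - i)))"
proof -
  have coeff: "fps_nth ((2 / (2 + fps_X)) ^ k :: 'a fps) i =
      (-1) ^ i / 2 ^ i * of_nat ((k + i - 1) choose i)" for i
    using assms(2) by (intro fps_nth_two_over_two_plus_fps_X_power) simp
  have "(changhee_poly k n :: 'a poly) =
      smult (fact n) (\<Sum>i=0..n. smult ((-1) ^ i / 2 ^ i * of_nat ((k + i - 1) choose i))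
        (binomial_poly (n - i)))"
    by (simp add: changhee_poly_def changhee_gf_def fps_const_poly_def
        one_plus_t_power_x_def fps_mult_nth coeff)
  also have "\<dots> = (\<Sum>i=0..n. smult ((-1) ^ i * (fact n / 2 ^ i) * of_nat ((k + i - 1) choose i))
      (binomial_poly (n - i)))"
    by (rule poly_eqI) (simp add: coeff_sum sum_distrib_left mult_ac)
  finally show ?thesis .
qed

end
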